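(* For all integers $n \geq 1$ and $k\ge 1$ and all real $x$, $$c_{n}^{(k)}(x) = \delta_{n,1} + (-1)^{n} n \sum_{m=1}^n \frac{1}{m} \genfrac{[}{]}{0pt}{}{n-1}{m-1}\sum_{j=1}^m \binom{m}{j} B_{m-j} \, \mathbb{C}_j^{(k)}(x+1)$$ and $$\widehat{c}_{n}^{(k)}(x) = \delta_{n,1} + (-1)^{n} n \sum_{m=1}^n \frac{1}{m} \genfrac{[}{]}{0pt}{}{n-1}{m-1}\sum_{j=1}^m (-1)^j \binom{m}{j} B_{m-j} \, \mathbb{C}_j^{(k)}(x-1),$$ where $\mathbb{C}_j^{(k)}(x)$ is the polynomial in $x$ of degree $j$ defined by $\mathbb{C}_0^{(k)}(x)=1$ and $$\mathbb{C}_j^{(k)}(x) = \sum_{i=0}^{j} \frac{(-1)^i}{(i+1)^k} \binom{j}{i} x^{j-i}, \qquad j \geq 1.$$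
   Context: For real $z$ and integer $n\ge 0$, $\binom{z}{n} = \frac{z(z-1)\cdots(z-n+1)}{n!}$. For integers $n\ge0$, $k\ge1$, the poly-Cauchy polynomials of the first and second kind are $$c_n^{(k)}(x) = n! \int_{0}^{1}\!\! \cdots \int_{0}^{1} \binom{t_1 \cdots t_k - x}{n}\,dt_1 \cdots dt_k,\qquad \widehat{c}_n^{(k)}(x) = n! \int_{0}^{1}\!\! \cdots \int_{0}^{1} \binom{x - t_1 \cdots t_k}{n}\,dt_1 \cdots dt_k.$$ $\genfrac{[}{]}{0pt}{}{n}{m}$ are the unsigned Stirling numbers of the first kind. $B_m$ are the Bernoulli numbers, $\frac{t}{e^t-1}=\sum_{m\ge0} B_m \frac{t^m}{m!}$ (so $B_1=-\tfrac12$). $\delta_{n,1}$ is the Kronecker delta. *)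

theory Defs
  imports
    "HOL-Analysis.Analysis"
    "HOL-Combinatorics.Stirling"
    "HOL-Computational_Algebra.Polynomial"
    "HOL-Computational_Algebra.Formal_Power_Series"
begin

(* The k-fold integral is the Lebesgue integral over the cube [0,1]^k inside the product of
   k copies of lborel; the integrand is continuous there, so this is the iterated integral. *)

definition poly_cauchy1 :: "nat \<Rightarrow> nat \<Rightarrow> real \<Rightarrow> real" where
  "poly_cauchy1 k n x =
     fact n * (LINT t : ({1..k} \<rightarrow>\<^sub>E {0..1}) | Pi\<^sub>M {1..k} (\<lambda>_. lborel).
       ((\<Prod>i\<in>{1..k}. t i) - x) gchoose n)"

definition poly_cauchy2 :: "nat \<Rightarrow> nat \<Rightarrow> real \<Rightarrow> real" where
  "poly_cauchy2 k n x =
     fact n * (LINT t : ({1..k} \<rightarrow>\<^sub>E {0..1}) | Pi\<^sub>M {1..k} (\<lambda>_. lborel).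
       (x - (\<Prod>i\<in>{1..k}. t i)) gchoose n)"

(* Exponential generating function X / (exp X - 1). Both series have subdegree 1, so the
   fps division below is the true quotient; the convention is B_1 = -1/2. *)
definition bernoulli_num :: "nat \<Rightarrow> real" where
  "bernoulli_num m = fact m * fps_nth (fps_X / (fps_exp 1 - 1)) m"

definition C_poly :: "nat \<Rightarrow> nat \<Rightarrow> real poly" where
  "C_poly k j = (if j = 0 then 1 else
     (\<Sum>i=0..j. monom ((-1) ^ i / (real i + 1) ^ k * real (j choose i)) (j - i)))"

end

theory Submission
  imports Defs
begin

text \<open>
  Put \<open>T = t\<^sub>1 \<cdots> t\<^sub>k\<close>. The moments of \<open>T\<close> over the unit cube are \<open>1 / (i + 1)\<^sup>k\<close>, so the polynomial
  \<open>C_poly k j\<close> at \<open>y\<close> is the integral of \<open>(y - T)\<^sup>j\<close>. Both formulas therefore result from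
  integrating a single polynomial identity for \<open>n! (v choose n)\<close>, read at \<open>v = T - x\<close> and at
  \<open>v = x - T\<close>. In the variable \<open>u = 1 - v\<close> that identity expresses
  \<open>(u - 1) u (u + 1) \<cdots> (u + n - 2)\<close> through Bernoulli polynomials; it holds because both sides have
  the forward difference \<open>n u (u + 1) \<cdots> (u + n - 2)\<close>, whose expansion in powers of \<open>u\<close> has Stirling
  numbers as coefficients, and because they agree at \<open>u = 0\<close> (where \<open>n = 1\<close> needs the correction term).
\<close>

text \<open>The linear coefficient of \<open>fps_exp 1 - 1\<close> is nonzero, so its subdegree is
  at most that of \<open>fps_X\<close> and the defining division is exact.\<close>

lemma bernoulli_num_fps:
  "Abs_fps (\<lambda>m. bernoulli_num m / fact m) * (fps_exp 1 - 1) = fps_X"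
proof -
  have nz: "fps_nth (fps_exp 1 - 1 :: real fps) 1 \<noteq> 0"
    by simp
  then have "fps_exp 1 - 1 \<noteq> (0 :: real fps)"
    by (metis fps_zero_nth)
  moreover have "subdegree (fps_exp 1 - 1 :: real fps) \<le> subdegree (fps_X :: real fps)"
    using subdegree_leI[OF nz] by simp
  moreover have "Abs_fps (\<lambda>m. bernoulli_num m / fact m) = fps_X / (fps_exp 1 - 1)"
    by (simp add: fps_eq_iff bernoulli_num_def)
  ultimately show ?thesis
    by (simp add: fps_times_divide_eq)
qed

text \<open>The difference equation of the Bernoulli polynomials, from comparing coefficients in
  (e^((u+1)X) - e^(uX)) * X/(e^X - 1) = X e^(uX). The term \<open>j = 0\<close> cancels, so the sum
  may start at 1.\<close>

lemma bernoulli_forward_difference: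
  fixes u :: real
  assumes "m \<ge> 1"
  shows "(\<Sum>j=1..m. real (m choose j) * bernoulli_num (m - j) * ((u + 1) ^ j - u ^ j))
         = real m * u ^ (m - 1)"
proof -
  let ?B = "Abs_fps (\<lambda>m. bernoulli_num m / fact m)"
  have "(fps_exp (u + 1) - fps_exp u) * ?B = ?B * (fps_exp 1 - 1) * fps_exp u"
    by (simp add: fps_exp_add_mult algebra_simps)
  also have "\<dots> = fps_X * fps_exp u"
    by (simp only: bernoulli_num_fps)
  finally have "fps_nth ((fps_exp (u + 1) - fps_exp u) * ?B) m = fps_nth (fps_X * fps_exp u) m"
    by simp
  also have "\<dots> = u ^ (m - 1) / fact (m - 1)"
    using assms by simp
  finally have "(\<Sum>j=0..m. ((u + 1) ^ j - u ^ j) / fact j * (bernoulli_num (m - j) / fact (m - j)))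
      = u ^ (m - 1) / fact (m - 1)"
    by (simp add: fps_mult_nth diff_divide_distrib)
  moreover have "(\<Sum>j=1..m. real (m choose j) * bernoulli_num (m - j) * ((u + 1) ^ j - u ^ j))
      = fact m * (\<Sum>j=0..m. ((u + 1) ^ j - u ^ j) / fact j * (bernoulli_num (m - j) / fact (m - j)))"
    unfolding sum_distrib_left
    by (subst (2) sum.atLeast_Suc_atMost) (auto intro!: sum.cong simp: binomial_fact)
  ultimately show ?thesis
    using assms by (simp add: fact_reduce)
qed

text \<open>By induction \<open>p\<close> takes the value \<open>poly p 0\<close> at every natural
  number, so \<open>p - [:poly p 0:]\<close> has infinitely many roots and vanishes.\<close>

lemma poly_eq_const_if_periodic:
  fixes p :: "'a :: {idom, ring_char_0} poly"
  assumes "\<And>u. poly p (u + 1) = poly p u"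
  shows "poly p u = poly p 0"
proof -
  have "poly p (of_nat i) = poly p 0" for i
  proof (induction i)
    case (Suc i)
    then show ?case
      using assms[of "of_nat i"] by (simp add: add.commute)
  qed simp
  then have "range (of_nat :: nat \<Rightarrow> 'a) \<subseteq> {u. poly (p - [:poly p 0:]) u = 0}"
    by auto
  then have "\<not> finite {u. poly (p - [:poly p 0:]) u = 0}"
    using finite_subset infinite_UNIV_char_0 range_inj_infinite inj_of_nat by metis
  then have "p - [:poly p 0:] = 0"
    using poly_roots_finite by blast
  then have "p = [:poly p 0:]"
    by simp
  then show ?thesis
    by (metis poly_pCons poly_0 mult_zero_right add_0_right)
qed

lemma pochhammer_eq_bernoulli_sum:
  fixes u :: real
  assumes "n \<ge> 1"
  shows "pochhammer (u - 1) n = (if n = 1 then -1 else 0) + real n *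
             (\<Sum>m=1..n. 1 / real m * real (stirling (n - 1) (m - 1)) *
               (\<Sum>j=1..m. real (m choose j) * bernoulli_num (m - j) * u ^ j))"
proof -
  define F :: "real \<Rightarrow> real" where "F = (\<lambda>u. real n *
             (\<Sum>m=1..n. 1 / real m * real (stirling (n - 1) (m - 1)) *
               (\<Sum>j=1..m. real (m choose j) * bernoulli_num (m - j) * u ^ j)))"
  \<comment> \<open>The left side minus \<open>F\<close>, as a formal polynomial so that periodicity
    can be exploited. The Stirling sum represents \<open>pochhammer u (n - 1)\<close>, and
    \<open>[:-1, 1:]\<close> is the remaining factor \<open>u - 1\<close>.\<close>
  define p :: "real poly" where
    "p = (\<Sum>i\<le>n - 1. monom (real (stirling (n - 1) i)) i) * [:-1, 1:]
       - smult (real n) (\<Sum>m=1..n. smult (1 / real m * real (stirling (n - 1) (m - 1)))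
               (\<Sum>j=1..m. monom (real (m choose j) * bernoulli_num (m - j)) j))"
  have poch: "pochhammer (v - 1) n = (v - 1) * pochhammer v (n - 1)" for v :: real
    using pochhammer_rec[of "v - 1" "n - 1"] assms by simp
  have p: "poly p v = pochhammer (v - 1) n - F v" for v
    unfolding poch
    by (simp add: p_def F_def poly_sum poly_monom left_diff_distrib
        flip: stirling_pochhammer)
  have F_diff: "F (v + 1) - F v = real n * pochhammer v (n - 1)" for v
  proof -
    have "F (v + 1) - F v = real n * (\<Sum>m=1..n. 1 / real m * real (stirling (n - 1) (m - 1)) *
        (\<Sum>j=1..m. real (m choose j) * bernoulli_num (m - j) * ((v + 1) ^ j - v ^ j)))"
      by (simp add: F_def sum_subtractf right_diff_distrib)
    also have "\<dots> = real n * (\<Sum>m=1..n. real (stirling (n - 1) (m - 1)) * v ^ (m - 1))"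
      by (intro arg_cong[where f = "\<lambda>s. real n * s"] sum.cong refl)
        (subst bernoulli_forward_difference; simp)
    also have "(\<Sum>m=1..n. real (stirling (n - 1) (m - 1)) * v ^ (m - 1))
        = (\<Sum>i\<le>n - 1. real (stirling (n - 1) i) * v ^ i)"
      by (rule sum.reindex_bij_witness[of _ Suc "\<lambda>m. m - 1"]) (use assms in auto)
    finally show ?thesis
      by (simp add: stirling_pochhammer)
  qed
  have "poly p (v + 1) = poly p v" for v
  proof -
    \<comment> \<open>Subtracting \<open>(v - 1) * pochhammer v (n - 1)\<close> from this leaves
      \<open>n * pochhammer v (n - 1)\<close>, the same difference as that of
      \<open>F\<close>.\<close>
    have "v * pochhammer (v + 1) (n - 1) = pochhammer v n"
      using pochhammer_rec[of v "n - 1"] assms by simp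
    also have "\<dots> = (v + real n - 1) * pochhammer v (n - 1)"
      using pochhammer_rec'[of v "n - 1"] assms by (simp add: of_nat_diff algebra_simps)
    finally show ?thesis
      using F_diff[of v] poch[of v] poch[of "v + 1"] unfolding p by (simp add: algebra_simps)
  qed
  then have "poly p u = poly p 0"
    by (rule poly_eq_const_if_periodic)
  moreover have "F 0 = 0"
    by (simp add: F_def)
  \<comment> \<open>The product contains the factor 0 as soon as \<open>n \<ge> 2\<close>; for
    \<open>n = 1\<close> only the factor -1 is present.\<close>
  moreover have "pochhammer (0 - 1 :: real) n = (if n = 1 then -1 else 0)"
    unfolding poch using assms by (auto simp: pochhammer_0_left)
  ultimately show ?thesis
    unfolding p by (simp add: F_def)
qed

text \<open>Reflection \<open>n! (v gchoose n) = (-1)^n pochhammer (-v) n\<close> with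
  \<open>-v = (1 - v) - 1\<close>; the sign turns the correction -1 at \<open>n = 1\<close> into
  1.\<close>

lemma gbinomial_eq_bernoulli_sum:
  fixes v :: real
  assumes "n \<ge> 1"
  shows "fact n * (v gchoose n) = (if n = 1 then 1 else 0) + (-1) ^ n * real n *
             (\<Sum>m=1..n. 1 / real m * real (stirling (n - 1) (m - 1)) *
               (\<Sum>j=1..m. real (m choose j) * bernoulli_num (m - j) * (1 - v) ^ j))"
proof -
  have "fact n * (v gchoose n) = (-1) ^ n * pochhammer ((1 - v) - 1) n"
    by (simp add: gbinomial_pochhammer)
  also have "\<dots> = (if n = 1 then 1 else 0) + (-1) ^ n * real n *
             (\<Sum>m=1..n. 1 / real m * real (stirling (n - 1) (m - 1)) *
               (\<Sum>j=1..m. real (m choose j) * bernoulli_num (m - j) * (1 - v) ^ j))"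
    unfolding pochhammer_eq_bernoulli_sum[OF assms] by (simp add: distrib_left)
  finally show ?thesis .
qed

text \<open>Restricting the space turns set integrals into plain ones, to which the linearity rules
  of \<open>has_bochner_integral\<close> apply directly.\<close>

definition unit_cube :: "nat \<Rightarrow> (nat \<Rightarrow> real) measure" where
  "unit_cube k = restrict_space (Pi\<^sub>M {1..k} (\<lambda>_. lborel)) ({1..k} \<rightarrow>\<^sub>E {0..1})"

lemma sets_PiE_unit_cube [measurable]:
  "({1..k} \<rightarrow>\<^sub>E {0..1}) \<in> sets (Pi\<^sub>M {1..k :: nat} (\<lambda>_. lborel :: real measure))"
  by (rule sets_PiM_I_finite) simp_all

lemma set_integral_unit_cube:
  "(LINT t : ({1..k} \<rightarrow>\<^sub>E {0..1}) | Pi\<^sub>M {1..k} (\<lambda>_. lborel). f t) = integral\<^sup>L (unit_cube k) f"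
  for f :: "(nat \<Rightarrow> real) \<Rightarrow> real"
  unfolding unit_cube_def set_lebesgue_integral_def
  by (subst integral_restrict_space) (auto intro: sets.Int sets_PiE_unit_cube)

text \<open>With the indicator of the cube included, the integrand is a product of functions of one
  coordinate each, so the integral is the product of \<open>k\<close> copies of the integral of
  \<open>s^j\<close> over [0,1].\<close>

lemma has_bochner_integral_unit_cube_power:
  "has_bochner_integral (unit_cube k) (\<lambda>t. (\<Prod>i\<in>{1..k}. t i) ^ j) (1 / (real j + 1) ^ k)"
proof -
  interpret product_sigma_finite "\<lambda>_ :: nat. lborel :: real measure"
    by standard
  let ?M = "Pi\<^sub>M {1..k} (\<lambda>_. lborel :: real measure)"
  let ?f = "\<lambda>s :: real. s ^ j * indicator {0..1} s"
  have int: "integrable lborel ?f"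
    using borel_integrable_atLeastAtMost[of 0 1 "\<lambda>s. s ^ j"]
    by (auto simp: indicator_def if_distrib cong: if_cong)
  have eq: "(\<Prod>i\<in>{1..k}. ?f (t i)) = indicator ({1..k} \<rightarrow>\<^sub>E {0..1}) t *\<^sub>R (\<Prod>i\<in>{1..k}. t i) ^ j"
    if "t \<in> space ?M" for t
  proof (cases "t \<in> {1..k} \<rightarrow>\<^sub>E {0..1}")
    case True
    then show ?thesis
      by (auto simp: prod_power_distrib PiE_iff intro!: prod.cong)
  next
    case False
    \<comment> \<open>Extensionality rules out the other way of leaving the cube, so some coordinate
      lies outside [0,1] and its factor is 0.\<close>
    moreover have "t \<in> extensional {1..k}"
      using that by (simp add: space_PiM PiE_iff)
    ultimately obtain i where "i \<in> {1..k}" "t i \<notin> {0..1}"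
      by (auto simp: PiE_iff)
    then have "\<exists>i\<in>{1..k}. ?f (t i) = 0"
      by (intro bexI[of _ i]) auto
    then have "(\<Prod>i\<in>{1..k}. ?f (t i)) = 0"
      by (intro prod_zero) auto
    then show ?thesis
      using False by simp
  qed
  have "integral\<^sup>L ?M (\<lambda>t. \<Prod>i\<in>{1..k}. ?f (t i)) = (\<Prod>i\<in>{1..k}. integral\<^sup>L lborel ?f)"
    by (rule product_integral_prod) (auto intro: int)
  also have "\<dots> = 1 / (real j + 1) ^ k"
    by (simp add: integral_power power_divide add.commute)
  finally have "has_bochner_integral ?M (\<lambda>t. \<Prod>i\<in>{1..k}. ?f (t i)) (1 / (real j + 1) ^ k)"
    using product_integrable_prod[of "{1..k}" "\<lambda>_. ?f"] int by (simp add: has_bochner_integral_iff)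
  then have "has_bochner_integral ?M
      (\<lambda>t. indicator ({1..k} \<rightarrow>\<^sub>E {0..1}) t *\<^sub>R (\<Prod>i\<in>{1..k}. t i) ^ j) (1 / (real j + 1) ^ k)"
    by (rule has_bochner_integral_cong[THEN iffD1, rotated -1]) (use eq in auto)
  then show ?thesis
    unfolding unit_cube_def has_bochner_integral_iff
    by (subst integrable_restrict_space, simp add: sets.Int, subst integral_restrict_space)
      (auto simp: sets.Int)
qed

lemma has_bochner_integral_unit_cube_C_poly:
  "has_bochner_integral (unit_cube k) (\<lambda>t. (y - (\<Prod>i\<in>{1..k}. t i)) ^ j) (poly (C_poly k j) y)"
proof -
  have "(y - T) ^ j = (\<Sum>i=0..j. (-1) ^ i * real (j choose i) * y ^ (j - i) * T ^ i)" for T :: real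
    using binomial_ring[of "- T" y j]
    by (simp add: power_minus[of T] atLeast0AtMost mult_ac)
  \<comment> \<open>At \<open>j = 0\<close> the general sum also equals 1, so the case split in
    \<open>C_poly\<close> does no harm.\<close>
  moreover have "poly (C_poly k j) y
      = (\<Sum>i=0..j. (-1) ^ i * real (j choose i) * y ^ (j - i) * (1 / (real i + 1) ^ k))"
    by (auto simp: C_poly_def poly_sum poly_monom intro!: sum.cong)
  ultimately show ?thesis
    by (simp only:)
      (intro has_bochner_integral_sum has_bochner_integral_mult_right
         has_bochner_integral_unit_cube_power)
qed

lemma degree_C_poly: "degree (C_poly k j) = j"
proof (cases "j = 0")
  case False
  have "coeff (C_poly k j) j
      = (\<Sum>i=0..j. if j - i = j then (-1) ^ i * real (j choose i) / (real i + 1) ^ k else 0)"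
    using False by (simp add: C_poly_def coeff_sum)
  \<comment> \<open>For \<open>j > 0\<close> only \<open>i = 0\<close> reaches degree
    \<open>j\<close>, and its coefficient is 1.\<close>
  also have "\<dots> = (\<Sum>i=0..j. if i = 0 then 1 else 0)"
    using False by (intro sum.cong) auto
  finally have "coeff (C_poly k j) j \<noteq> 0"
    by simp
  moreover have "degree (C_poly k j) \<le> j"
    unfolding C_poly_def
    by (auto intro!: degree_sum_le order.trans[OF degree_monom_le])
  ultimately show ?thesis
    by (simp add: le_degree order_antisym)
qed (simp add: C_poly_def)

text \<open>The pointwise identity is linear in the powers of \<open>1 - g t\<close>, so integrating
  replaces each power by its moment \<open>c j\<close>. Both kinds of polynomial are
  instances.\<close>

lemma integral_unit_cube_gbinomial:
  assumes "n \<ge> 1"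
    and "\<And>j. has_bochner_integral (unit_cube k) (\<lambda>t. (1 - g t) ^ j) (c j)"
  shows "fact n * integral\<^sup>L (unit_cube k) (\<lambda>t. g t gchoose n) =
           (if n = 1 then 1 else 0) + (-1) ^ n * real n *
             (\<Sum>m=1..n. 1 / real m * real (stirling (n - 1) (m - 1)) *
               (\<Sum>j=1..m. real (m choose j) * bernoulli_num (m - j) * c j))"
proof -
  \<comment> \<open>The moment of order 0 says that the cube has total mass 1.\<close>
  have const: "has_bochner_integral (unit_cube k) (\<lambda>t. a) a" for a :: real
    using has_bochner_integral_mult_right[OF has_bochner_integral_unit_cube_power[of k 0], of a]
    by simp
  have "has_bochner_integral (unit_cube k) (\<lambda>t. fact n * (g t gchoose n))
          ((if n = 1 then 1 else 0) + (-1) ^ n * real n *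
             (\<Sum>m=1..n. 1 / real m * real (stirling (n - 1) (m - 1)) *
               (\<Sum>j=1..m. real (m choose j) * bernoulli_num (m - j) * c j)))"
    unfolding gbinomial_eq_bernoulli_sum[OF assms(1)]
    by (intro has_bochner_integral_add const has_bochner_integral_mult_right
        has_bochner_integral_sum assms(2))
  then show ?thesis
    by (auto dest: has_bochner_integral_integral_eq)
qed

theorem theorem9:
  fixes n k :: nat and x :: real
  assumes "n \<ge> 1" and "k \<ge> 1"
  shows "poly_cauchy1 k n x =
           (if n = 1 then 1 else 0) + (-1) ^ n * real n *
             (\<Sum>m=1..n. 1 / real m * real (stirling (n - 1) (m - 1)) *
               (\<Sum>j=1..m. real (m choose j) * bernoulli_num (m - j) * poly (C_poly k j) (x + 1)))
         \<and> poly_cauchy2 k n x =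
           (if n = 1 then 1 else 0) + (-1) ^ n * real n *
             (\<Sum>m=1..n. 1 / real m * real (stirling (n - 1) (m - 1)) *
               (\<Sum>j=1..m. (-1) ^ j * real (m choose j) * bernoulli_num (m - j) * poly (C_poly k j) (x - 1)))
         \<and> (\<forall>j. degree (C_poly k j) = j)"
proof (intro conjI allI)
  let ?T = "\<lambda>t :: nat \<Rightarrow> real. \<Prod>i\<in>{1..k}. t i"
  have "has_bochner_integral (unit_cube k) (\<lambda>t. (1 - (?T t - x)) ^ j) (poly (C_poly k j) (x + 1))"
    for j
    using has_bochner_integral_unit_cube_C_poly[of k "x + 1" j] by (simp add: algebra_simps)
  from integral_unit_cube_gbinomial[OF assms(1) this]
  show "poly_cauchy1 k n x =
           (if n = 1 then 1 else 0) + (-1) ^ n * real n *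
             (\<Sum>m=1..n. 1 / real m * real (stirling (n - 1) (m - 1)) *
               (\<Sum>j=1..m. real (m choose j) * bernoulli_num (m - j) * poly (C_poly k j) (x + 1)))"
    unfolding poly_cauchy1_def set_integral_unit_cube .
  \<comment> \<open>Here \<open>1 - (x - T) = -((x - 1) - T)\<close>, which explains both the
    argument \<open>x - 1\<close> and the sign \<open>(-1)^j\<close>.\<close>
  have "has_bochner_integral (unit_cube k) (\<lambda>t. (1 - (x - ?T t)) ^ j)
          ((-1) ^ j * poly (C_poly k j) (x - 1))" for j
  proof -
    have "(1 - (x - T)) ^ j = (-1) ^ j * (x - 1 - T) ^ j" for T
      unfolding power_mult_distrib[symmetric] by (simp add: algebra_simps)
    then show ?thesis
      by (simp only:)
        (intro has_bochner_integral_mult_right has_bochner_integral_unit_cube_C_poly)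
  qed
  from integral_unit_cube_gbinomial[OF assms(1) this]
  show "poly_cauchy2 k n x =
           (if n = 1 then 1 else 0) + (-1) ^ n * real n *
             (\<Sum>m=1..n. 1 / real m * real (stirling (n - 1) (m - 1)) *
               (\<Sum>j=1..m. (-1) ^ j * real (m choose j) * bernoulli_num (m - j) * poly (C_poly k j) (x - 1)))"
    unfolding poly_cauchy2_def set_integral_unit_cube by (simp only: mult_ac)
qed (rule degree_C_poly)

end
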